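(* Let $\mathbf{y}\sim N(\boldsymbol\mu,\Sigma)$ in $\mathbb{R}^n$, let $\boldsymbol\eta\in\mathbb{R}^n$ satisfy $\boldsymbol\eta^T\Sigma\boldsymbol\eta>0$, and let $A\in\mathbb{R}^{m\times n}$, $\mathbf{b}\in\mathbb{R}^m$ satisfy $\mathbb{P}(A\mathbf{y}\le\mathbf{b})>0$. With $\mathbf{z}$, $\mathcal{V}^-$, $\mathcal{V}^+$ and $F^{[a,b]}_{\mu,\sigma^2}$ as defined in the context, conditionally on the event $\{A\mathbf{y}\le\mathbf{b}\}$, $$F_{\boldsymbol\eta^T\boldsymbol\mu,\ \boldsymbol\eta^T\Sigma\boldsymbol\eta}^{[\mathcal{V}^-(\mathbf{z}),\,\mathcal{V}^+(\mathbf{z})]}\bigl(\boldsymbol\eta^T\mathbf{y}\bigr)\ \Big|\ \{A\mathbf{y}\le\mathbf{b}\}\ \sim\ \mathrm{Unif}(0,1).$$ Furthermore, for (almost every) value $\mathbf{z}_0$ of $\mathbf{z}$ (with respect to the law of $\mathbf{z}$ given $A\mathbf{y}\le\mathbf{b}$), $$\bigl[\boldsymbol\eta^T\mathbf{y}\ \big|\ A\mathbf{y}\le\mathbf{b},\ \mathbf{z}=\mathbf{z}_0\bigr]\ \sim\ \mathrm{TN}\bigl(\boldsymbol\eta^T\boldsymbol\mu,\ \boldsymbol\eta^T\Sigma\boldsymbol\eta,\ \mathcal{V}^-(\mathbf{z}_0),\ \mathcal{V}^+(\mathbf{z}_0)\bigr).$$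
   Context: Vector inequalities are componentwise. Define $\mathbf{c}=\Sigma\boldsymbol\eta(\boldsymbol\eta^T\Sigma\boldsymbol\eta)^{-1}\in\mathbb{R}^n$ and the random vector $\mathbf{z}=(I_n-\mathbf{c}\boldsymbol\eta^T)\mathbf{y}$. For $\mathbf{z}\in\mathbb{R}^n$ define $$\mathcal{V}^-(\mathbf{z})=\max_{j:(A\mathbf{c})_j<0}\frac{b_j-(A\mathbf{z})_j}{(A\mathbf{c})_j},\qquad \mathcal{V}^+(\mathbf{z})=\min_{j:(A\mathbf{c})_j>0}\frac{b_j-(A\mathbf{z})_j}{(A\mathbf{c})_j},$$ where a maximum over the empty set is $-\infty$ and a minimum over the empty set is $+\infty$. For $-\infty\le a<b\le\infty$, $\mu\in\mathbb{R}$, $\sigma>0$, $\mathrm{TN}(\mu,\sigma^2,a,b)$ denotes the law of a $N(\mu,\sigma^2)$ random variable conditioned to lie in $[a,b]$, and $F^{[a,b]}_{\mu,\sigma^2}$ denotes its CDF, i.e. for $x\in[a,b]$ $$F_{\mu,\sigma^2}^{[a,b]}(x)=\frac{\Phi((x-\mu)/\sigma)-\Phi((a-\mu)/\sigma)}{\Phi((b-\mu)/\sigma)-\Phi((a-\mu)/\sigma)},$$ with $\Phi$ the standard normal CDF. The conditional law given $\mathbf{z}=\mathbf{z}_0$ is understood as a regular conditional distribution. *)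

theory Defs
  imports "HOL-Probability.Probability"
begin

section \<open>Multivariate normal random vectors\<close>

definition std_gaussian :: "(real^'n) measure" where
  "std_gaussian = density lborel (\<lambda>x. ennreal (\<Prod>i\<in>UNIV. std_normal_density (x $ i)))"

text \<open>
  \<open>y \<sim> N(\<mu>, \<Sigma>)\<close> if \<open>y\<close> has the law of \<open>\<mu> + B g\<close> with \<open>g\<close> a vector of independent standard normals
  and \<open>B B\<^sup>T = \<Sigma>\<close>. A square \<open>B\<close> exists exactly when \<open>\<Sigma>\<close> is symmetric positive semidefinite, and \<open>\<Sigma>\<close>
  may be singular, in which case the law has no Lebesgue density.
\<close>

definition multivariate_normal ::
    "'a measure \<Rightarrow> ('a \<Rightarrow> real^'n) \<Rightarrow> real^'n \<Rightarrow> real^'n^'n \<Rightarrow> bool" where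
  "multivariate_normal M y \<mu> \<Sigma> \<longleftrightarrow>
     y \<in> borel_measurable M \<and>
     (\<exists>B :: real^'n^'n. B ** transpose B = \<Sigma> \<and>
        distr M borel y = distr std_gaussian borel (\<lambda>g. \<mu> + B *v g))"


section \<open>The truncated normal distribution\<close>

text \<open>The second parameter \<open>v\<close> is the variance; the truncation bounds may be infinite.\<close>

definition trunc_normal :: "real \<Rightarrow> real \<Rightarrow> ereal \<Rightarrow> ereal \<Rightarrow> real measure" where
  "trunc_normal \<mu> v a b =
     uniform_measure (density lborel (\<lambda>x. ennreal (normal_density \<mu> (sqrt v) x)))
       {x. a \<le> ereal x \<and> ereal x \<le> b}"

definition trunc_normal_cdf :: "real \<Rightarrow> real \<Rightarrow> ereal \<Rightarrow> ereal \<Rightarrow> real \<Rightarrow> real" where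
  "trunc_normal_cdf \<mu> v a b x = cdf (trunc_normal \<mu> v a b) x"

definition std_normal_cdf :: "ereal \<Rightarrow> real" where
  "std_normal_cdf x = measure (density lborel (\<lambda>t. ennreal (std_normal_density t))) {t. ereal t \<le> x}"

lemma measure_normal_le:
  assumes "s > 0"
  shows "measure (density lborel (\<lambda>t. ennreal (normal_density \<mu> s t))) {t. ereal t \<le> x} =
    std_normal_cdf ((x - ereal \<mu>) / ereal s)"
proof -
  let ?N = "density lborel (\<lambda>t. ennreal (normal_density \<mu> s t))"
  interpret N: prob_space ?N
    using assms by (rule prob_space_normal_density)
  have "distr ?N lborel (\<lambda>t. t) = ?N"
    by (rule distr_id2) simp
  then have "distributed ?N lborel (\<lambda>t. t) (\<lambda>t. ennreal (normal_density \<mu> s t))"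
    by (auto simp: distributed_def)
  then have *: "distributed ?N lborel (\<lambda>t. (t - \<mu>) / s) (\<lambda>t. ennreal (std_normal_density t))"
    using N.normal_standard_normal_convert[OF assms, of "\<lambda>t. t" \<mu>] by simp
  have iff: "ereal ((t - \<mu>) / s) \<le> (x - ereal \<mu>) / ereal s \<longleftrightarrow> ereal t \<le> x" for t
    using assms by (cases x) (auto simp: divide_simps)
  have "std_normal_cdf ((x - ereal \<mu>) / ereal s) =
      measure (distr ?N lborel (\<lambda>t. (t - \<mu>) / s)) {t. ereal t \<le> (x - ereal \<mu>) / ereal s}"
    using * by (simp add: std_normal_cdf_def distributed_def)
  also have "\<dots> = measure ?N {t. ereal t \<le> x}"
    by (subst measure_distr) (auto simp: iff vimage_def)
  finally show ?thesis ..
qed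

lemma trunc_normal_cdf_eq:
  assumes "v > 0" "a < b" "a \<le> ereal x" "ereal x \<le> b"
  shows "trunc_normal_cdf \<mu> v a b x =
    (std_normal_cdf ((ereal x - ereal \<mu>) / ereal (sqrt v)) - std_normal_cdf ((a - ereal \<mu>) / ereal (sqrt v))) /
    (std_normal_cdf ((b - ereal \<mu>) / ereal (sqrt v)) - std_normal_cdf ((a - ereal \<mu>) / ereal (sqrt v)))"
proof -
  let ?N = "density lborel (\<lambda>t. ennreal (normal_density \<mu> (sqrt v) t))"
  let ?I = "{t. a \<le> ereal t \<and> ereal t \<le> b}"
  have s: "sqrt v > 0" using assms by simp
  interpret N: prob_space ?N
    using s by (rule prob_space_normal_density)
  have null: "emeasure ?N {t} = 0" for t
    by (simp add: emeasure_density nn_integral_indicator_singleton)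
  have interval: "measure ?N {t. a \<le> ereal t \<and> ereal t \<le> c} =
      measure ?N {t. ereal t \<le> c} - measure ?N {t. ereal t \<le> a}" if "a \<le> c" for c
  proof -
    have "measure ?N {t. a \<le> ereal t \<and> ereal t \<le> c} = measure ?N ({t. ereal t \<le> c} - {t. ereal t \<le> a})"
    proof (rule N.finite_measure_eq_AE)
      have "AE t in ?N. t \<noteq> real_of_ereal a"
        by (rule AE_I[where N="{real_of_ereal a}"]) (auto simp: null)
      then show "AE t in ?N. t \<in> {t. a \<le> ereal t \<and> ereal t \<le> c} \<longleftrightarrow>
          t \<in> {t. ereal t \<le> c} - {t. ereal t \<le> a}"
        by eventually_elim (cases a; auto)
    qed auto
    also have "\<dots> = measure ?N {t. ereal t \<le> c} - measure ?N {t. ereal t \<le> a}"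
      using that by (intro N.finite_measure_Diff) (auto intro: order_trans)
    finally show ?thesis .
  qed
  have pos: "emeasure ?N ?I \<noteq> 0"
  proof
    assume "emeasure ?N ?I = 0"
    then have "AE t in ?N. t \<notin> ?I"
      by (intro AE_I[where N="?I"]) auto
    then have "AE t in lborel. t \<notin> ?I"
      using normal_density_pos[OF s] by (simp add: AE_density)
    then have z: "emeasure lborel ?I = 0"
      by (subst (asm) AE_iff_measurable[where N="?I"]) auto
    obtain p where p: "a < ereal p" "ereal p < b"
      using assms(2) ereal_dense2 by blast
    obtain q where q: "ereal p < ereal q" "ereal q < b"
      using p(2) ereal_dense2 by blast
    have "{p..q} \<subseteq> ?I"
      using p q by (auto intro: order_trans[OF less_imp_le] order_trans[OF _ less_imp_le])
        (meson ereal_less_eq(3) le_less_trans less_imp_le order.strict_trans1 order.trans)+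
    then have "emeasure lborel {p..q} \<le> emeasure lborel ?I"
      by (intro emeasure_mono) auto
    then show False using z q(1) by simp
  qed
  have "trunc_normal_cdf \<mu> v a b x = measure ?N (?I \<inter> {..x}) / measure ?N ?I"
    unfolding trunc_normal_cdf_def trunc_normal_def cdf_def
    using pos by (subst measure_uniform_measure) auto
  also have "?I \<inter> {..x} = {t. a \<le> ereal t \<and> ereal t \<le> ereal x}"
    using assms(4) by (auto intro: order_trans[of _ "ereal x"])
  finally show ?thesis
    using assms by (simp only: interval measure_normal_le[OF s] less_imp_le)
qed


section \<open>Regular conditional distributions\<close>

text \<open>
  \<open>K\<close> is a regular conditional distribution of the \<open>S\<close>-valued \<open>X\<close> given the \<open>T\<close>-valued \<open>Z\<close>: a Markov
  kernel from \<open>T\<close> to \<open>S\<close> which disintegrates the joint law of \<open>X\<close> and \<open>Z\<close>.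
\<close>

definition regular_cond_distr ::
    "'a measure \<Rightarrow> 'b measure \<Rightarrow> 'c measure \<Rightarrow> ('a \<Rightarrow> 'b) \<Rightarrow> ('a \<Rightarrow> 'c) \<Rightarrow> ('c \<Rightarrow> 'b measure) \<Rightarrow> bool" where
  "regular_cond_distr M S T X Z K \<longleftrightarrow>
     X \<in> measurable M S \<and> Z \<in> measurable M T \<and> K \<in> measurable T (prob_algebra S) \<and>
     (\<forall>B\<in>sets S. \<forall>C\<in>sets T.
        emeasure M {\<omega>\<in>space M. X \<omega> \<in> B \<and> Z \<omega> \<in> C} =
        (\<integral>\<^sup>+z\<in>C. emeasure (K z) B \<partial>(distr M T Z)))"


section \<open>The truncation limits of the polyhedral lemma\<close>

definition sel_dir :: "real^'n^'n \<Rightarrow> real^'n \<Rightarrow> real^'n" where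
  "sel_dir \<Sigma> \<eta> = inverse (\<eta> \<bullet> (\<Sigma> *v \<eta>)) *\<^sub>R (\<Sigma> *v \<eta>)"

definition sel_resid :: "real^'n^'n \<Rightarrow> real^'n \<Rightarrow> real^'n \<Rightarrow> real^'n" where
  "sel_resid \<Sigma> \<eta> y =
     (mat 1 - (columnvector (sel_dir \<Sigma> \<eta>) :: real^1^'n) ** (rowvector \<eta> :: real^'n^1)) *v y"

text \<open>
  The index sets are finite, so the extrema in \<^typ>\<open>ereal\<close> below are maxima and minima, except for the
  empty index set, where they are \<open>-\<infinity>\<close> and \<open>+\<infinity>\<close> respectively.
\<close>

definition V_minus :: "real^'n^'m \<Rightarrow> real^'m \<Rightarrow> real^'n \<Rightarrow> real^'n \<Rightarrow> ereal" where
  "V_minus A b c z = (SUP j\<in>{j. (A *v c) $ j < 0}. ereal ((b $ j - (A *v z) $ j) / (A *v c) $ j))"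

definition V_plus :: "real^'n^'m \<Rightarrow> real^'m \<Rightarrow> real^'n \<Rightarrow> real^'n \<Rightarrow> ereal" where
  "V_plus A b c z = (INF j\<in>{j. (A *v c) $ j > 0}. ereal ((b $ j - (A *v z) $ j) / (A *v c) $ j))"

end

theory Submission
  imports Defs
begin

text \<open>
  If \<open>g\<close> is standard Gaussian, \<open>s\<close> an independent standard normal and \<open>u\<close> a unit vector, then
  rotating \<open>(g, s)\<close> by a right angle in the plane of \<open>u\<close> and the last axis replaces \<open>u \<bullet> g\<close> by \<open>s\<close>
  without changing the joint law. Hence \<open>u \<bullet> g\<close> is independent of every function of \<open>g\<close> that is
  invariant along \<open>u\<close>, in particular \<open>\<eta> \<bullet> y\<close> is independent of the residual \<open>z\<close>. Since
  \<open>y = z + (\<eta> \<bullet> y) c\<close>, the event \<open>A y \<le> b\<close> confines \<open>\<eta> \<bullet> y\<close> to an interval depending on \<open>z\<close> only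
  (and restricts \<open>z\<close> through the rows with \<open>(A c)\<^sub>j = 0\<close>), so conditioning truncates the fibre laws.
  The law of the pivot is then uniform on almost every fibre by the probability integral transform.
\<close>

section \<open>Independence of Gaussian components\<close>

text \<open>Fubini: the slice at \<open>x\<close> of the preimage of \<open>A\<close> is the
  preimage of the slice of \<open>A\<close> under \<open>f x\<close>, which has the same
  \<open>N\<close>-measure. This covers shears that move only the second coordinate.\<close>

lemma distr_pair_snd_invariant:
  assumes "sigma_finite_measure N"
    and f: "case_prod f \<in> measurable (M \<Otimes>\<^sub>M N) N"
    and inv: "\<And>x. x \<in> space M \<Longrightarrow> distr N N (f x) = N"
  shows "distr (M \<Otimes>\<^sub>M N) (M \<Otimes>\<^sub>M N) (\<lambda>(x, y). (x, f x y)) = M \<Otimes>\<^sub>M N"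
proof (rule measure_eqI)
  interpret N: sigma_finite_measure N by fact
  note [measurable] = f
  have fx: "f x \<in> measurable N N" if "x \<in> space M" for x
    using measurable_Pair2[OF f that] by simp
  fix A assume "A \<in> sets (distr (M \<Otimes>\<^sub>M N) (M \<Otimes>\<^sub>M N) (\<lambda>(x, y). (x, f x y)))"
  then have A: "A \<in> sets (M \<Otimes>\<^sub>M N)" by simp
  let ?g = "\<lambda>(x, y). (x, f x y)"
  have g: "?g \<in> measurable (M \<Otimes>\<^sub>M N) (M \<Otimes>\<^sub>M N)" by measurable
  have "emeasure (distr (M \<Otimes>\<^sub>M N) (M \<Otimes>\<^sub>M N) ?g) A
      = (\<integral>\<^sup>+x. emeasure N (Pair x -` (?g -` A \<inter> space (M \<Otimes>\<^sub>M N))) \<partial>M)"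
    using measurable_sets[OF g A] by (simp add: emeasure_distr[OF g A] N.emeasure_pair_measure_alt)
  also have "\<dots> = (\<integral>\<^sup>+x. emeasure N (Pair x -` A) \<partial>M)"
  proof (rule nn_integral_cong)
    fix x assume x: "x \<in> space M"
    have "Pair x -` (?g -` A \<inter> space (M \<Otimes>\<^sub>M N)) = f x -` (Pair x -` A) \<inter> space N"
      using x by (auto simp: space_pair_measure)
    then have "emeasure N (Pair x -` (?g -` A \<inter> space (M \<Otimes>\<^sub>M N))) = emeasure (distr N N (f x)) (Pair x -` A)"
      using fx[OF x] sets_Pair1[OF A] by (simp add: emeasure_distr)
    then show "emeasure N (Pair x -` (?g -` A \<inter> space (M \<Otimes>\<^sub>M N))) = emeasure N (Pair x -` A)"
      using inv[OF x] by simp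
  qed
  finally show "emeasure (distr (M \<Otimes>\<^sub>M N) (M \<Otimes>\<^sub>M N) ?g) A = emeasure (M \<Otimes>\<^sub>M N) A"
    using A by (simp add: N.emeasure_pair_measure_alt)
qed simp

text \<open>Conjugating the previous shear by the coordinate swap exchanges the roles of the
  factors.\<close>

lemma distr_pair_fst_invariant:
  assumes M: "sigma_finite_measure M" and N: "sigma_finite_measure N"
    and f: "case_prod f \<in> measurable (M \<Otimes>\<^sub>M N) M"
    and inv: "\<And>y. y \<in> space N \<Longrightarrow> distr M M (\<lambda>x. f x y) = M"
  shows "distr (M \<Otimes>\<^sub>M N) (M \<Otimes>\<^sub>M N) (\<lambda>(x, y). (f x y, y)) = M \<Otimes>\<^sub>M N"
proof -
  interpret P: pair_sigma_finite M N using M N by (rule pair_sigma_finite.intro)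
  note [measurable] = f
  let ?s = "\<lambda>(x, y). (y, x)"
  have "distr (N \<Otimes>\<^sub>M M) (N \<Otimes>\<^sub>M M) (\<lambda>(y, x). (y, f x y)) = N \<Otimes>\<^sub>M M"
    by (rule distr_pair_snd_invariant[OF M]) (use inv in simp_all)
  then have "M \<Otimes>\<^sub>M N = distr (distr (N \<Otimes>\<^sub>M M) (N \<Otimes>\<^sub>M M) (\<lambda>(y, x). (y, f x y))) (M \<Otimes>\<^sub>M N) ?s"
    by (simp flip: P.distr_pair_swap)
  also have "\<dots> = distr (N \<Otimes>\<^sub>M M) (M \<Otimes>\<^sub>M N) (\<lambda>(y, x). (f x y, y))"
    by (subst distr_distr) (auto intro!: distr_cong)
  also have "\<dots> = distr (distr (N \<Otimes>\<^sub>M M) (M \<Otimes>\<^sub>M N) ?s) (M \<Otimes>\<^sub>M N) (\<lambda>(x, y). (f x y, y))"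
    by (subst distr_distr) (auto intro!: distr_cong)
  finally show ?thesis by (simp flip: P.distr_pair_swap)
qed

section \<open>Rotation invariance of Lebesgue and Gaussian measure\<close>

abbreviation std_normal :: "real measure" where
  "std_normal \<equiv> density lborel (\<lambda>x. ennreal (std_normal_density x))"

lemma lborel_translate: "distr lborel lborel (\<lambda>x. x + c) = (lborel :: 'a::euclidean_space measure)"
  using lborel_distr_plus[of c] by (simp add: add.commute cong: distr_cong)

text \<open>The map rotates the plane spanned by \<open>u\<close> and the last axis by a right angle, so it is a product
  of three shears, each of which preserves Lebesgue measure by Fubini and translation invariance.\<close>

lemma distr_lborel_rotation:
  fixes u :: "real^'n"
  assumes u: "u \<bullet> u = 1"
  shows "distr (lborel \<Otimes>\<^sub>M lborel) (lborel \<Otimes>\<^sub>M lborel) (\<lambda>(g, s). (g + (s - u \<bullet> g) *\<^sub>R u, - (u \<bullet> g)))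
    = (lborel \<Otimes>\<^sub>M lborel :: ((real^'n) \<times> real) measure)"
proof -
  let ?L = "lborel \<Otimes>\<^sub>M lborel :: ((real^'n) \<times> real) measure"
  let ?S = "\<lambda>(g, s). (g, s - u \<bullet> g)" and ?T = "\<lambda>(g, s). (g + s *\<^sub>R u, s)"
  have S: "distr ?L ?L ?S = ?L"
    using lborel_translate[of "- (u \<bullet> g)" for g]
    by (intro distr_pair_snd_invariant) (simp_all add: lborel.sigma_finite_measure_axioms)
  have T: "distr ?L ?L ?T = ?L"
    by (rule distr_pair_fst_invariant) (simp_all add: lborel_translate lborel.sigma_finite_measure_axioms)
  have S': "?S \<in> measurable ?L ?L" and T': "?T \<in> measurable ?L ?L"
    by measurable
  have "?L = distr (distr (distr ?L ?L ?S) ?L ?T) ?L ?S"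
    by (simp only: S T)
  also have "\<dots> = distr ?L ?L (?S \<circ> (?T \<circ> ?S))"
    by (simp only: distr_distr[OF T' S'] distr_distr[OF S' measurable_comp[OF S' T']]
        distr_distr[OF S' T'] distr_distr[OF measurable_comp[OF S' T'] S'])
  \<comment> \<open>The last shear leaves \<open>s - u \<bullet> g - u \<bullet> (g + (s - u
    \<bullet> g) *\<^sub>R u)\<close> in the second coordinate; since
    \<open>u \<bullet> u = 1\<close>, this collapses to \<open>- (u \<bullet> g)\<close>.\<close>
  also have "?S \<circ> (?T \<circ> ?S) = (\<lambda>(g, s). (g + (s - u \<bullet> g) *\<^sub>R u, - (u \<bullet> g)))"
  proof (rule ext)
    fix p :: "(real^'n) \<times> real"
    obtain g s where "p = (g, s)" by (cases p)
    then show "(?S \<circ> (?T \<circ> ?S)) p = (\<lambda>(g, s). (g + (s - u \<bullet> g) *\<^sub>R u, - (u \<bullet> g))) p"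
      by (simp add: inner_right_distrib u)
  qed
  finally show ?thesis ..
qed

text \<open>Exhibits the density as radial, so that invariance under a rotation reduces to
  preservation of the squared norm.\<close>

lemma prod_std_normal_density:
  fixes x :: "real^'n"
  shows "(\<Prod>i\<in>UNIV. std_normal_density (x $ i)) = (1 / sqrt (2 * pi)) ^ CARD('n) * exp (- (x \<bullet> x) / 2)"
proof -
  have "- (x \<bullet> x) / 2 = (\<Sum>i\<in>UNIV. - (x $ i)\<^sup>2 / 2)"
    by (simp add: inner_vec_def power2_eq_square sum_negf sum_divide_distrib)
  then show ?thesis
    by (simp add: std_normal_density_def prod.distrib exp_sum power_divide prod_dividef)
qed

text \<open>Lebesgue measure is invariant under the rotation, and the joint density depends on
  \<open>(g, s)\<close> only through \<open>g \<bullet> g + s\<^sup>2\<close>, which the rotation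
  preserves.\<close>

lemma distr_std_gaussian_rotation:
  fixes u :: "real^'n"
  assumes u: "u \<bullet> u = 1"
  shows "distr (std_gaussian \<Otimes>\<^sub>M std_normal) (lborel \<Otimes>\<^sub>M lborel)
    (\<lambda>(g, s). (g + (s - u \<bullet> g) *\<^sub>R u, - (u \<bullet> g))) = std_gaussian \<Otimes>\<^sub>M std_normal"
proof -
  let ?L = "lborel \<Otimes>\<^sub>M lborel :: ((real^'n) \<times> real) measure"
  let ?R = "\<lambda>(g, s). (g + (s - u \<bullet> g) *\<^sub>R u, - (u \<bullet> g))"
  define d :: "real^'n \<Rightarrow> ennreal" where "d = (\<lambda>g. ennreal (\<Prod>i\<in>UNIV. std_normal_density (g $ i)))"
  have [measurable]: "d \<in> borel_measurable borel" unfolding d_def by simp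
  let ?f = "\<lambda>(g, s). d g * ennreal (std_normal_density s)"
  interpret N: prob_space std_normal
    by (rule prob_space_normal_density) simp
  have R: "?R \<in> measurable ?L ?L" by measurable
  have D: "std_gaussian \<Otimes>\<^sub>M std_normal = density ?L ?f"
    unfolding std_gaussian_def d_def[symmetric]
    by (intro pair_measure_density) (simp_all add: lborel.sigma_finite_measure_axioms N.sigma_finite_measure_axioms)
  have norm: "?f (?R p) = ?f p" for p
  proof (cases p)
    case (Pair g s)
    have "(g + (s - u \<bullet> g) *\<^sub>R u) \<bullet> (g + (s - u \<bullet> g) *\<^sub>R u) + (u \<bullet> g)\<^sup>2 = g \<bullet> g + s\<^sup>2"
      using u by (simp add: inner_simps inner_commute power2_eq_square algebra_simps)
    then have *: "exp (- ((g + (s - u \<bullet> g) *\<^sub>R u) \<bullet> (g + (s - u \<bullet> g) *\<^sub>R u)) / 2) * exp (- (u \<bullet> g)\<^sup>2 / 2)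
        = exp (- (g \<bullet> g) / 2) * exp (- s\<^sup>2 / 2)"
      by (simp flip: exp_add)
    have "(\<Prod>i\<in>UNIV. std_normal_density ((g + (s - u \<bullet> g) *\<^sub>R u) $ i)) * std_normal_density (- (u \<bullet> g))
        = (\<Prod>i\<in>UNIV. std_normal_density (g $ i)) * std_normal_density s"
      using * unfolding prod_std_normal_density by (simp add: std_normal_density_def)
    then show ?thesis
      unfolding Pair d_def by (simp only: prod.case ennreal_mult''[OF normal_density_nonneg, symmetric])
  qed
  have "density ?L ?f = density (distr ?L ?L ?R) ?f"
    by (simp only: distr_lborel_rotation[OF u])
  also have "\<dots> = distr (density ?L (\<lambda>p. ?f (?R p))) ?L ?R"
    by (rule density_distr[OF _ R]) measurable
  also have "(\<lambda>p. ?f (?R p)) = ?f" by (intro ext norm)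
  finally show ?thesis by (simp only: D)
qed

text \<open>The hypothesis \<open>inv\<close> says that \<open>h\<close> ignores the component along
  \<open>u\<close>. The rotation therefore leaves \<open>h g\<close> alone and replaces
  \<open>u \<bullet> g\<close> by the independent coordinate \<open>s\<close>.\<close>

lemma distr_std_gaussian_split:
  fixes u :: "real^'n" and h :: "real^'n \<Rightarrow> 'b::second_countable_topology"
  assumes u: "u \<bullet> u = 1" and h[measurable]: "h \<in> borel_measurable borel"
    and inv: "\<And>x t. h (x + t *\<^sub>R u) = h x"
  shows "distr std_gaussian (borel \<Otimes>\<^sub>M borel) (\<lambda>g. (h g, u \<bullet> g)) = distr std_gaussian borel h \<Otimes>\<^sub>M std_normal"
proof -
  interpret N: prob_space std_normal by (rule prob_space_normal_density) simp
  have [measurable_cong]: "sets (std_gaussian :: (real^'n) measure) = sets borel"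
    by (simp add: std_gaussian_def)
  let ?GN = "(std_gaussian :: (real^'n) measure) \<Otimes>\<^sub>M std_normal"
  let ?R = "\<lambda>(g, s). (g + (s - u \<bullet> g) *\<^sub>R u, - (u \<bullet> g))"
  have [measurable]: "?R \<in> measurable ?GN (lborel \<Otimes>\<^sub>M lborel)" by measurable
  \<comment> \<open>Adjoins the auxiliary normal coordinate by viewing \<open>std_gaussian\<close>
    as a marginal of the product.\<close>
  have "distr ?GN std_gaussian fst = (std_gaussian :: (real^'n) measure)"
    by (rule N.distr_pair_fst)
  then have "distr std_gaussian (borel \<Otimes>\<^sub>M borel) (\<lambda>g. (h g, u \<bullet> g))
      = distr (distr ?GN std_gaussian fst) (borel \<Otimes>\<^sub>M borel) (\<lambda>g. (h g, u \<bullet> g))"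
    by simp
  also have "\<dots> = distr ?GN (borel \<Otimes>\<^sub>M borel) (\<lambda>p. (h (fst p), u \<bullet> fst p))"
    by (subst distr_distr) (auto simp: comp_def)
  \<comment> \<open>The rotation may be inserted because it preserves the law of
    \<open>(g, s)\<close>; the next step uses that the rotated vector has inner product
    \<open>s\<close> with \<open>u\<close>.\<close>
  also have "\<dots> = distr (distr ?GN (lborel \<Otimes>\<^sub>M lborel) ?R) (borel \<Otimes>\<^sub>M borel) (\<lambda>p. (h (fst p), u \<bullet> fst p))"
    by (simp only: distr_std_gaussian_rotation[OF u])
  also have "\<dots> = distr ?GN (borel \<Otimes>\<^sub>M borel) (\<lambda>(g, s). (h g, s))"
    by (subst distr_distr) (auto simp: comp_def inv inner_simps u intro!: distr_cong)
  also have "\<dots> = distr std_gaussian borel h \<Otimes>\<^sub>M distr std_normal borel (\<lambda>s. s)"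
    by (rule pair_measure_distr[symmetric])
      (simp_all add: prob_space.prob_space_distr[OF N.prob_space_axioms] prob_space_imp_sigma_finite)
  also have "distr std_normal borel (\<lambda>s. s) = std_normal"
    by (rule distr_id2) simp
  finally show ?thesis .
qed


section \<open>Truncation of an independent coordinate\<close>

lemma cdf_uniform_measure_unit_interval:
  "cdf (uniform_measure lborel {0<..<1::real}) t = max 0 (min 1 t)"
proof -
  have "{0<..<1::real} \<inter> {..t} = (if t \<le> 0 then {} else if t < 1 then {0<..t} else {0<..<1})"
    by auto
  then show ?thesis
    by (simp add: cdf_def measure_uniform_measure)
qed

text \<open>Between the bounds \<open>Q {F < t} \<le> t \<le> Q {F \<le> t}\<close> any
  flat pieces of \<open>F\<close> are harmless.\<close>

lemma distr_cdf_uniform: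
  assumes "real_distribution Q" and atomless: "\<And>x. measure Q {x} = 0"
  shows "distr Q borel (cdf Q) = uniform_measure lborel {0<..<1}"
proof (rule cdf_unique)
  interpret Q: real_distribution Q by fact
  let ?F = "cdf Q"
  have mono: "mono ?F" by (simp add: mono_def Q.cdf_nondecreasing)
  then have F[measurable]: "?F \<in> borel_measurable borel" by (rule borel_measurable_mono)
  show "real_distribution (distr Q borel ?F)" by (rule Q.real_distribution_distr) simp
  have "prob_space (uniform_measure lborel {0<..<1::real})"
    by (rule prob_space_uniform_measure) simp_all
  then show "real_distribution (uniform_measure lborel {0<..<1})"
    by (simp add: real_distribution_def real_distribution_axioms_def)
  have bounds: "measure Q {x. ?F x < t} \<le> t \<and> t \<le> measure Q {x. ?F x \<le> t}" if t: "0 < t" "t < 1" for t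
  proof -
    obtain l where l: "?F l < t"
      using order_tendstoD(2)[OF Q.cdf_lim_neg_infty t(1)] by (auto simp: eventually_sequentially)
    obtain r where r: "?F r > t"
      using order_tendstoD(1)[OF Q.cdf_lim_infty_prob t(2)] by (auto simp: eventually_sequentially)
    have "l \<le> r" using monoD[OF mono, of r l] l r by linarith
    \<comment> \<open>Without atoms the cdf is continuous, so it attains \<open>t\<close>. Then
      \<open>{..x}\<close> has measure exactly \<open>t\<close> and lies between the two level sets
      to be compared.\<close>
    then obtain x where x: "?F x = t"
      using IVT[of ?F l t r] l r by (auto simp: Q.isCont_cdf atomless)
    have "y \<le> x" if "?F y < t" for y
      using monoD[OF mono, of x y] x that by (cases "y \<le> x") auto
    then have "measure Q {x. ?F x < t} \<le> measure Q {..x}"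
      by (intro Q.finite_measure_mono) auto
    moreover have "measure Q {..x} \<le> measure Q {x. ?F x \<le> t}"
      using monoD[OF mono, of _ x] x by (intro Q.finite_measure_mono) auto
    ultimately show ?thesis using x by (simp add: cdf_def)
  qed
  show "cdf (distr Q borel ?F) = cdf (uniform_measure lborel {0<..<1})"
  proof
    fix t
    have "cdf (distr Q borel ?F) t = measure Q {x. ?F x \<le> t}"
      by (simp add: cdf_def[of "distr Q borel (cdf Q)"] measure_distr vimage_def)
    also have "\<dots> = max 0 (min 1 t)"
    proof (cases "0 \<le> t \<and> t < 1")
      case True
      \<comment> \<open>The upper bound in \<open>bounds\<close> concerns the strict level set, so
        it is applied at \<open>s > t\<close> and \<open>s\<close> then decreases to
        \<open>t\<close>. Since \<open>bounds\<close> excludes 0, the lower bound below treats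
        \<open>t = 0\<close> separately.\<close>
      have "measure Q {x. ?F x \<le> t} \<le> s" if "t < s" "s < 1" for s
      proof -
        have "measure Q {x. ?F x \<le> t} \<le> measure Q {x. ?F x < s}"
          using that by (intro Q.finite_measure_mono) auto
        then show ?thesis using bounds[of s] that True by auto
      qed
      then have "measure Q {x. ?F x \<le> t} \<le> t"
        using True by (intro dense_ge_bounded[of t 1]) auto
      moreover have "t \<le> measure Q {x. ?F x \<le> t}"
        using bounds[of t] True by (cases "t = 0") auto
      ultimately show ?thesis using True by simp
    next
      case False
      then consider "t < 0" | "1 \<le> t" by linarith
      then show ?thesis
      proof cases
        case 1
        then have "{x. ?F x \<le> t} = {}" using Q.cdf_nonneg by (auto simp: not_le intro: less_le_trans)
        with 1 show ?thesis by simp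
      next
        case 2
        then have "{x. ?F x \<le> t} = space Q" using Q.cdf_bounded_prob by (auto intro: order_trans)
        with 2 show ?thesis using Q.prob_space by simp
      qed
    qed
    finally show "cdf (distr Q borel ?F) t = cdf (uniform_measure lborel {0<..<1}) t"
      by (simp add: cdf_uniform_measure_unit_interval)
  qed
qed

section \<open>Almost sure uniqueness of regular conditional distributions\<close>

lemma real_distribution_eqI_Rats:
  assumes "real_distribution Q" "real_distribution R"
    and eq: "\<And>q. q \<in> \<rat> \<Longrightarrow> cdf Q q = cdf R q"
  shows "Q = R"
proof -
  have le: "cdf Q x \<le> cdf R x" if "real_distribution Q" "real_distribution R"
    and eq: "\<And>q. q \<in> \<rat> \<Longrightarrow> cdf Q q = cdf R q" for Q R x
  proof -
    interpret Q: real_distribution Q by fact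
    interpret R: real_distribution R by fact
    have "cdf Q x \<le> cdf R y" if xy: "x < y" for y
    proof -
      obtain q where q: "q \<in> \<rat>" "x < q" "q < y" using Rats_dense_in_real[OF xy] by blast
      have "cdf Q x \<le> cdf Q q" using q by (intro Q.cdf_nondecreasing) simp
      also have "\<dots> \<le> cdf R y" unfolding eq[OF q(1)] using q by (intro R.cdf_nondecreasing) simp
      finally show ?thesis .
    qed
    \<comment> \<open>Letting \<open>y\<close> decrease to \<open>x\<close>, right continuity closes
      the gap opened by passing through a rational strictly between them.\<close>
    then have "\<forall>\<^sub>F y in at_right x. cdf Q x \<le> cdf R y"
      by (auto simp: eventually_at_filter)
    then show ?thesis
      using R.cdf_is_right_cont[of x] by (intro tendsto_lowerbound[of "cdf R"]) (auto simp: continuous_within)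
  qed
  show ?thesis
    using assms le[of Q R] le[of R Q] by (intro cdf_unique ext antisym) auto
qed

text \<open>For fixed \<open>B\<close> both kernels are densities of the same measure of
  \<open>C\<close>, hence agree almost everywhere. The null set depends on \<open>B\<close>, so only
  countably many half-lines are compared; these determine a real distribution.\<close>

lemma regular_cond_distr_unique:
  fixes X :: "'a \<Rightarrow> real" and T :: "'b measure"
  assumes "prob_space P" and K: "regular_cond_distr P borel T X Z K" and L: "regular_cond_distr P borel T X Z L"
  shows "AE z in distr P T Z. K z = L z"
proof -
  interpret P: prob_space P by fact
  have [measurable]: "Z \<in> measurable P T" "K \<in> measurable T (prob_algebra borel)" "L \<in> measurable T (prob_algebra borel)"
    using K L by (auto simp: regular_cond_distr_def)
  interpret D: prob_space "distr P T Z" by (rule P.prob_space_distr) simp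
  have J: "(\<lambda>z. emeasure (J z) B) \<in> borel_measurable T"
    if "J \<in> measurable T (prob_algebra borel)" "B \<in> sets borel" for J :: "'b \<Rightarrow> real measure" and B
    using measurable_compose[OF measurable_prob_algebraD measurable_emeasure_subprob_algebra] that .
  have "AE z in distr P T Z. emeasure (K z) B = emeasure (L z) B" if B[measurable]: "B \<in> sets borel" for B
  proof (rule D.density_unique)
    have [measurable]: "(\<lambda>z. emeasure (K z) B) \<in> borel_measurable T" "(\<lambda>z. emeasure (L z) B) \<in> borel_measurable T"
      by (simp_all add: J)
    show "density (distr P T Z) (\<lambda>z. emeasure (K z) B) = density (distr P T Z) (\<lambda>z. emeasure (L z) B)"
    proof (rule measure_eqI)
      fix C assume "C \<in> sets (density (distr P T Z) (\<lambda>z. emeasure (K z) B))"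
      then have C: "C \<in> sets T" by simp
      have "(\<integral>\<^sup>+z\<in>C. emeasure (J z) B \<partial>(distr P T Z)) = emeasure P {\<omega>\<in>space P. X \<omega> \<in> B \<and> Z \<omega> \<in> C}"
        if "regular_cond_distr P borel T X Z J" for J
        using that B C unfolding regular_cond_distr_def by simp
      from this[OF K] this[OF L]
      have "(\<integral>\<^sup>+z\<in>C. emeasure (K z) B \<partial>(distr P T Z)) = (\<integral>\<^sup>+z\<in>C. emeasure (L z) B \<partial>(distr P T Z))"
        by simp
      then show "emeasure (density (distr P T Z) (\<lambda>z. emeasure (K z) B)) C
          = emeasure (density (distr P T Z) (\<lambda>z. emeasure (L z) B)) C"
        using C by (simp add: emeasure_density)
    qed simp
  qed (simp_all add: J)
  then have "AE z in distr P T Z. \<forall>q\<in>\<rat>. emeasure (K z) {..q} = emeasure (L z) {..q}"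
    by (subst AE_ball_countable) (auto simp: countable_rat)
  then show ?thesis
  proof (rule AE_mp, intro AE_I2 impI)
    fix z assume z: "z \<in> space (distr P T Z)" and eq: "\<forall>q\<in>\<rat>. emeasure (K z) {..q} = emeasure (L z) {..q}"
    have "real_distribution (J z)" if "J \<in> measurable T (prob_algebra borel)" for J
      using measurable_space[OF that, of z] z
      by (auto simp: space_prob_algebra real_distribution_def real_distribution_axioms_def)
    then have "real_distribution (K z)" "real_distribution (L z)"
      by simp_all
    then show "K z = L z"
      by (rule real_distribution_eqI_Rats) (use eq in \<open>simp add: cdf_def measure_def\<close>)
  qed
qed

text \<open>Isolates the conditioning argument from the Gaussian one. By \<open>indep\<close>,
  \<open>X\<close> has law \<open>N\<close> and is independent of \<open>Z\<close>. The selection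
  event splits into a constraint \<open>S\<close> on \<open>Z\<close> alone and an interval for
  \<open>X\<close> whose ends depend on \<open>Z\<close>.\<close>

locale truncation = prob_space M + N: prob_space N
  for M :: "'a measure" and N :: "real measure" +
  fixes T :: "'b measure" and X :: "'a \<Rightarrow> real" and Z :: "'a \<Rightarrow> 'b" and S :: "'b set" and l u :: "'b \<Rightarrow> ereal"
  assumes sets_N[measurable_cong, simp]: "sets N = sets borel"
    and atomless: "\<And>x. emeasure N {x} = 0"
    and X[measurable]: "X \<in> borel_measurable M"
    and Z[measurable]: "Z \<in> measurable M T"
    and indep: "distr M (T \<Otimes>\<^sub>M borel) (\<lambda>\<omega>. (Z \<omega>, X \<omega>)) = distr M T Z \<Otimes>\<^sub>M N"
    and S[measurable]: "S \<in> sets T"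
    and l[measurable]: "l \<in> borel_measurable T"
    and u[measurable]: "u \<in> borel_measurable T"
    and positive: "emeasure M {\<omega>\<in>space M. Z \<omega> \<in> S \<and> l (Z \<omega>) \<le> ereal (X \<omega>) \<and> ereal (X \<omega>) \<le> u (Z \<omega>)} > 0"
begin

definition E :: "'a set" where
  "E = {\<omega>\<in>space M. Z \<omega> \<in> S \<and> l (Z \<omega>) \<le> ereal (X \<omega>) \<and> ereal (X \<omega>) \<le> u (Z \<omega>)}"

definition P :: "'a measure" where
  "P = uniform_measure M E"

definition I :: "'b \<Rightarrow> real set" where
  "I z = {x. l z \<le> ereal x \<and> ereal x \<le> u z}"

definition N_trunc :: "'b \<Rightarrow> real measure" where
  "N_trunc z = uniform_measure N (I z)"

lemma space_N[simp]: "space N = UNIV"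
  using sets_eq_imp_space_eq[OF sets_N] by simp

lemma sets_N_trunc[simp, measurable_cong]: "sets (N_trunc z) = sets borel"
  by (simp add: N_trunc_def)

lemma space_N_trunc[simp]: "space (N_trunc z) = UNIV"
  by (simp add: N_trunc_def)

lemma sets_I[measurable, simp]: "I z \<in> sets borel"
  by (simp add: I_def)

lemma sets_E[measurable]: "E \<in> sets M"
  unfolding E_def by measurable

lemma sets_P[simp, measurable_cong]: "sets P = sets M"
  by (simp add: P_def)

lemma space_P[simp]: "space P = space M"
  by (simp add: P_def)

lemma emeasure_E: "emeasure M E \<noteq> 0" "emeasure M E \<noteq> \<infinity>"
  using positive by (auto simp: E_def)

lemma prob_space_P: "prob_space P"
  unfolding P_def using emeasure_E by (rule prob_space_uniform_measure)

lemma prob_space_N_trunc: "emeasure N (I z) \<noteq> 0 \<Longrightarrow> prob_space (N_trunc z)"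
  unfolding N_trunc_def by (rule prob_space_uniform_measure) auto

lemma emeasure_N_trunc:
  "B \<in> sets borel \<Longrightarrow> emeasure (N_trunc z) B = emeasure N (I z \<inter> B) / emeasure N (I z)"
  by (simp add: N_trunc_def)

section \<open>Disintegration of the conditioned law\<close>

lemma measurable_emeasure_I[measurable]:
  assumes D: "D \<in> sets (T \<Otimes>\<^sub>M borel)"
  shows "(\<lambda>z. emeasure N (I z \<inter> Pair z -` D)) \<in> borel_measurable T"
proof (rule N.measurable_emeasure)
  have "{p \<in> space (T \<Otimes>\<^sub>M N). snd p \<in> I (fst p) \<inter> Pair (fst p) -` D}
      = {p \<in> space (T \<Otimes>\<^sub>M borel). l (fst p) \<le> ereal (snd p) \<and> ereal (snd p) \<le> u (fst p) \<and> p \<in> D}"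
    by (auto simp: I_def space_pair_measure)
  also have "\<dots> \<in> sets (T \<Otimes>\<^sub>M borel)"
    using D by measurable
  finally show "{p \<in> space (T \<Otimes>\<^sub>M N). snd p \<in> I (fst p) \<inter> Pair (fst p) -` D} \<in> sets (T \<Otimes>\<^sub>M N)"
    by (simp cong: sets_pair_measure_cong)
qed simp

lemma measurable_emeasure_I'[measurable]: "(\<lambda>z. emeasure N (I z)) \<in> borel_measurable T"
proof -
  have "(\<lambda>z. emeasure N (I z)) \<in> borel_measurable T \<longleftrightarrow>
      (\<lambda>z. emeasure N (I z \<inter> Pair z -` space (T \<Otimes>\<^sub>M borel))) \<in> borel_measurable T"
    by (rule measurable_cong) (auto simp: space_pair_measure intro!: arg_cong[where f="emeasure N"])
  then show ?thesis using measurable_emeasure_I[OF sets.top] by simp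
qed

text \<open>Fubini for the product law of \<open>(Z, X)\<close>: the event \<open>E\<close> cuts the
  fibre over \<open>z\<close> down to \<open>I z\<close>, and removes it if \<open>z\<close> lies
  outside \<open>S\<close>. The only normalisation so far is the global one by the mass of
  \<open>E\<close>.\<close>

lemma emeasure_P_pair:
  assumes D: "D \<in> sets (T \<Otimes>\<^sub>M borel)"
  shows "emeasure P {\<omega>\<in>space M. (Z \<omega>, X \<omega>) \<in> D}
    = (\<integral>\<^sup>+z. indicator S z * emeasure N (I z \<inter> Pair z -` D) \<partial>distr M T Z) / emeasure M E"
proof -
  let ?G = "{p \<in> space (T \<Otimes>\<^sub>M borel). fst p \<in> S \<and> snd p \<in> I (fst p) \<and> p \<in> D}"
  have G: "?G \<in> sets (T \<Otimes>\<^sub>M borel)"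
    using D unfolding I_def by measurable
  have "E \<inter> {\<omega>\<in>space M. (Z \<omega>, X \<omega>) \<in> D} = (\<lambda>\<omega>. (Z \<omega>, X \<omega>)) -` ?G \<inter> space M"
    using measurable_space[OF Z] by (auto simp: E_def I_def space_pair_measure)
  then have "emeasure M (E \<inter> {\<omega>\<in>space M. (Z \<omega>, X \<omega>) \<in> D})
      = emeasure (distr M (T \<Otimes>\<^sub>M borel) (\<lambda>\<omega>. (Z \<omega>, X \<omega>))) ?G"
    using G by (simp add: emeasure_distr)
  also have "\<dots> = (\<integral>\<^sup>+z. emeasure N (Pair z -` ?G) \<partial>distr M T Z)"
    unfolding indep using G
    by (intro N.emeasure_pair_measure_alt) (simp cong: sets_pair_measure_cong)
  also have "\<dots> = (\<integral>\<^sup>+z. indicator S z * emeasure N (I z \<inter> Pair z -` D) \<partial>distr M T Z)"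
  proof (rule nn_integral_cong)
    fix z assume "z \<in> space (distr M T Z)"
    then have "Pair z -` ?G = (if z \<in> S then I z \<inter> Pair z -` D else {})"
      by (auto simp: space_pair_measure)
    then show "emeasure N (Pair z -` ?G) = indicator S z * emeasure N (I z \<inter> Pair z -` D)"
      by simp
  qed
  finally show ?thesis
    using D by (simp add: P_def)
qed

text \<open>The case \<open>D = C \<times> UNIV\<close> of the preceding formula: conditioning
  reweights the law of \<open>Z\<close> by the mass of the truncation interval.\<close>

lemma distr_P_Z:
  "distr P T Z = density (distr M T Z) (\<lambda>z. indicator S z * emeasure N (I z) / emeasure M E)"
proof (rule measure_eqI)
  fix C assume "C \<in> sets (distr P T Z)"
  then have C[measurable]: "C \<in> sets T" by simp
  have "emeasure (distr P T Z) C = emeasure P {\<omega>\<in>space M. (Z \<omega>, X \<omega>) \<in> C \<times> UNIV}"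
    using C by (subst emeasure_distr) (auto intro!: arg_cong[where f="emeasure P"])
  also have "\<dots> = (\<integral>\<^sup>+z. indicator S z * emeasure N (I z) * indicator C z \<partial>distr M T Z) / emeasure M E"
    by (subst emeasure_P_pair)
      (auto intro!: arg_cong2[where f="(/)"] nn_integral_cong split: split_indicator)
  also have "\<dots> = emeasure (density (distr M T Z) (\<lambda>z. indicator S z * emeasure N (I z) / emeasure M E)) C"
    by (subst nn_integral_divide[symmetric])
      (auto simp: emeasure_density divide_ennreal_def mult_ac intro!: nn_integral_cong)
  finally show "emeasure (distr P T Z) C
    = emeasure (density (distr M T Z) (\<lambda>z. indicator S z * emeasure N (I z) / emeasure M E)) C" .
qed simp

text \<open>The density of the conditioned law of \<open>Z\<close> contains the factor
  \<open>emeasure N (I z)\<close>, so fibres with a null interval carry no mass.\<close>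

lemma AE_emeasure_I: "AE z in distr P T Z. emeasure N (I z) \<noteq> 0"
  unfolding distr_P_Z by (subst AE_density) auto

text \<open>The weight \<open>emeasure N (I z)\<close> in the conditioned law of \<open>Z\<close>
  cancels the normalising constant of \<open>N_trunc z\<close>.\<close>

lemma emeasure_P_disintegration:
  assumes D: "D \<in> sets (T \<Otimes>\<^sub>M borel)"
  shows "emeasure P {\<omega>\<in>space M. (Z \<omega>, X \<omega>) \<in> D} = (\<integral>\<^sup>+z. emeasure (N_trunc z) (Pair z -` D) \<partial>distr P T Z)"
proof -
  have D': "Pair z -` D \<in> sets borel" for z using D by (rule sets_Pair1)
  note [measurable] = measurable_emeasure_I[OF D]
  have "(\<integral>\<^sup>+z. emeasure (N_trunc z) (Pair z -` D) \<partial>distr P T Z)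
      = (\<integral>\<^sup>+z. indicator S z * emeasure N (I z) / emeasure M E * (emeasure N (I z \<inter> Pair z -` D) / emeasure N (I z)) \<partial>distr M T Z)"
    unfolding distr_P_Z emeasure_N_trunc[OF D'] by (subst nn_integral_density) auto
  also have "\<dots> = (\<integral>\<^sup>+z. indicator S z * emeasure N (I z \<inter> Pair z -` D) / emeasure M E \<partial>distr M T Z)"
  proof (rule nn_integral_cong)
    fix z
    have "emeasure N (I z) * (emeasure N (I z \<inter> Pair z -` D) / emeasure N (I z)) = emeasure N (I z \<inter> Pair z -` D)"
    \<comment> \<open>On a null interval there is nothing to cancel, but both sides vanish by
      monotonicity.\<close>
    proof (cases "emeasure N (I z) = 0")
      case True
      then have "emeasure N (I z \<inter> Pair z -` D) = 0"
        using emeasure_mono[of "I z \<inter> Pair z -` D" "I z" N] by simp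
      with True show ?thesis by simp
    next
      case False
      then show ?thesis
        using ennreal_mult_divide_eq[of "emeasure N (I z)" "emeasure N (I z \<inter> Pair z -` D)"]
        by (simp add: ennreal_times_divide mult.commute)
    qed
    moreover have "indicator S z * emeasure N (I z) / emeasure M E * (emeasure N (I z \<inter> Pair z -` D) / emeasure N (I z))
        = indicator S z * (emeasure N (I z) * (emeasure N (I z \<inter> Pair z -` D) / emeasure N (I z))) / emeasure M E"
      by (simp add: divide_ennreal_def mult_ac)
    ultimately show "indicator S z * emeasure N (I z) / emeasure M E * (emeasure N (I z \<inter> Pair z -` D) / emeasure N (I z))
        = indicator S z * emeasure N (I z \<inter> Pair z -` D) / emeasure M E"
      by simp
  qed
  also have "\<dots> = emeasure P {\<omega>\<in>space M. (Z \<omega>, X \<omega>) \<in> D}"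
    unfolding emeasure_P_pair[OF D] by (rule nn_integral_divide) auto
  finally show ?thesis ..
qed

text \<open>\<^const>\<open>N_trunc\<close> is not a probability measure where the truncation interval is null, so a
  Markov kernel needs another value there.\<close>

definition kernel :: "'b \<Rightarrow> real measure" where
  "kernel z = (if emeasure N (I z) = 0 then N else N_trunc z)"

lemma measurable_kernel: "kernel \<in> measurable T (prob_algebra borel)"
proof (rule measurable_prob_algebraI)
  show prob: "prob_space (kernel z)" for z
    using prob_space_N_trunc[of z] N.prob_space_axioms by (simp add: kernel_def)
  show "kernel \<in> measurable T (subprob_algebra borel)"
  proof (rule measurable_subprob_algebra)
    show "subprob_space (kernel z)" for z using prob by (rule prob_space_imp_subprob_space)
    show "sets (kernel z) = sets borel" for z by (simp add: kernel_def)
    fix B :: "real set" assume B[measurable]: "B \<in> sets borel"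
    have "(\<lambda>z. emeasure N (I z \<inter> B)) \<in> borel_measurable T \<longleftrightarrow>
        (\<lambda>z. emeasure N (I z \<inter> Pair z -` (space T \<times> B))) \<in> borel_measurable T"
      by (rule measurable_cong) (auto intro!: arg_cong[where f="emeasure N"])
    then have [measurable]: "(\<lambda>z. emeasure N (I z \<inter> B)) \<in> borel_measurable T"
      using measurable_emeasure_I[of "space T \<times> B"] by simp
    have "(\<lambda>z. emeasure (kernel z) B)
        = (\<lambda>z. if emeasure N (I z) = 0 then emeasure N B else emeasure N (I z \<inter> B) / emeasure N (I z))"
      by (auto simp: kernel_def emeasure_N_trunc)
    then show "(\<lambda>z. emeasure (kernel z) B) \<in> borel_measurable T" by simp
  qed
qed

lemma AE_kernel: "AE z in distr P T Z. kernel z = N_trunc z"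
  using AE_emeasure_I by eventually_elim (simp add: kernel_def)

lemma regular_cond_distr_kernel: "regular_cond_distr P borel T X Z kernel"
  unfolding regular_cond_distr_def
proof (intro conjI ballI measurable_kernel)
  fix B :: "real set" and C assume B: "B \<in> sets borel" and C: "C \<in> sets T"
  have "emeasure P {\<omega>\<in>space P. X \<omega> \<in> B \<and> Z \<omega> \<in> C} = emeasure P {\<omega>\<in>space M. (Z \<omega>, X \<omega>) \<in> C \<times> B}"
    by (auto intro!: arg_cong[where f="emeasure P"])
  also have "\<dots> = (\<integral>\<^sup>+z. emeasure (N_trunc z) (Pair z -` (C \<times> B)) \<partial>distr P T Z)"
    using B C by (intro emeasure_P_disintegration) simp
  also have "\<dots> = (\<integral>\<^sup>+z\<in>C. emeasure (kernel z) B \<partial>distr P T Z)"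
    by (rule nn_integral_cong_AE, use AE_kernel in eventually_elim) (simp split: split_indicator)
  finally show "emeasure P {\<omega>\<in>space P. X \<omega> \<in> B \<and> Z \<omega> \<in> C} = (\<integral>\<^sup>+z\<in>C. emeasure (kernel z) B \<partial>distr P T Z)" .
qed simp_all

lemma regular_cond_distr_AE_N_trunc:
  assumes "regular_cond_distr P borel T X Z K"
  shows "AE z in distr P T Z. K z = N_trunc z"
  using regular_cond_distr_unique[OF prob_space_P assms regular_cond_distr_kernel] AE_kernel
  by eventually_elim simp

section \<open>Uniform law of the pivot\<close>

lemma measurable_cdf_N_trunc[measurable]:
  "(\<lambda>p. cdf (N_trunc (fst p)) (snd p)) \<in> borel_measurable (T \<Otimes>\<^sub>M borel)"
proof -
  \<comment> \<open>The pivot evaluates a varying cdf at a varying point, so measurability is needed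
    jointly. The pair is treated as a single parameter of the set being measured.\<close>
  have "(\<lambda>p. emeasure N (I (fst p) \<inter> {..snd p})) \<in> borel_measurable (T \<Otimes>\<^sub>M borel)"
  proof (rule N.measurable_emeasure)
    have "{q \<in> space ((T \<Otimes>\<^sub>M borel) \<Otimes>\<^sub>M N). snd q \<in> I (fst (fst q)) \<inter> {..snd (fst q)}}
        = {q \<in> space ((T \<Otimes>\<^sub>M borel) \<Otimes>\<^sub>M N).
            l (fst (fst q)) \<le> ereal (snd q) \<and> ereal (snd q) \<le> u (fst (fst q)) \<and> snd q \<le> snd (fst q)}"
      by (auto simp: I_def)
    also have "\<dots> \<in> sets ((T \<Otimes>\<^sub>M borel) \<Otimes>\<^sub>M N)"
      by measurable
    finally show "{q \<in> space ((T \<Otimes>\<^sub>M borel) \<Otimes>\<^sub>M N). snd q \<in> I (fst (fst q)) \<inter> {..snd (fst q)}}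
        \<in> sets ((T \<Otimes>\<^sub>M borel) \<Otimes>\<^sub>M N)" .
  qed simp
  then show ?thesis
    by (simp add: cdf_def measure_def emeasure_N_trunc)
qed

lemma measurable_cdf_N_trunc_pair: "(\<lambda>\<omega>. cdf (N_trunc (Z \<omega>)) (X \<omega>)) \<in> borel_measurable P"
  using measurable_compose[OF _ measurable_cdf_N_trunc, of "\<lambda>\<omega>. (Z \<omega>, X \<omega>)" M] by simp

text \<open>Truncation creates no atoms, so the probability integral transform applies on each fibre
  of positive mass.\<close>

lemma distr_cdf_N_trunc:
  assumes "emeasure N (I z) \<noteq> 0"
  shows "distr (N_trunc z) borel (cdf (N_trunc z)) = uniform_measure lborel {0<..<1}"
proof (rule distr_cdf_uniform)
  show "real_distribution (N_trunc z)"
    using prob_space_N_trunc[OF assms] by (simp add: real_distribution_def real_distribution_axioms_def)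
  fix x
  have "emeasure N (I z \<inter> {x}) \<le> emeasure N {x}" by (rule emeasure_mono) auto
  then show "measure (N_trunc z) {x} = 0"
    by (simp add: measure_def emeasure_N_trunc atomless)
qed

text \<open>Almost every fibre contributes the same uniform measure of \<open>B\<close>. Integrating
  this constant against the probability law of \<open>Z\<close> returns it.\<close>

lemma distr_cdf_N_trunc_pair:
  "distr P borel (\<lambda>\<omega>. cdf (N_trunc (Z \<omega>)) (X \<omega>)) = uniform_measure lborel {0<..<1}"
proof (rule measure_eqI)
  interpret D: prob_space "distr P T Z" by (rule prob_space.prob_space_distr[OF prob_space_P]) simp
  fix B assume "B \<in> sets (distr P borel (\<lambda>\<omega>. cdf (N_trunc (Z \<omega>)) (X \<omega>)))"
  then have B[measurable]: "B \<in> sets borel" by simp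
  let ?D = "{p \<in> space (T \<Otimes>\<^sub>M borel). cdf (N_trunc (fst p)) (snd p) \<in> B}"
  have "emeasure (distr P borel (\<lambda>\<omega>. cdf (N_trunc (Z \<omega>)) (X \<omega>))) B = emeasure P {\<omega>\<in>space M. (Z \<omega>, X \<omega>) \<in> ?D}"
    using measurable_space[OF Z] measurable_cdf_N_trunc_pair
    by (subst emeasure_distr) (auto simp: space_pair_measure intro!: arg_cong[where f="emeasure P"])
  also have "\<dots> = (\<integral>\<^sup>+z. emeasure (N_trunc z) (Pair z -` ?D) \<partial>distr P T Z)"
    by (rule emeasure_P_disintegration) measurable
  also have "\<dots> = (\<integral>\<^sup>+z. emeasure (uniform_measure lborel {0<..<1}) B \<partial>distr P T Z)"
  proof (rule nn_integral_cong_AE, use AE_emeasure_I in \<open>rule AE_mp\<close>, intro AE_I2 impI)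
    fix z assume z: "z \<in> space (distr P T Z)" and pos: "emeasure N (I z) \<noteq> 0"
    have "(\<lambda>x. cdf (N_trunc z) x) \<in> borel_measurable borel"
      using measurable_compose[OF measurable_Pair1' measurable_cdf_N_trunc, of z] z by simp
    then have "emeasure (distr (N_trunc z) borel (cdf (N_trunc z))) B = emeasure (N_trunc z) (Pair z -` ?D)"
      using z by (subst emeasure_distr)
        (auto simp: space_pair_measure intro!: arg_cong2[where f=emeasure])
    then show "emeasure (N_trunc z) (Pair z -` ?D) = emeasure (uniform_measure lborel {0<..<1}) B"
      by (simp only: distr_cdf_N_trunc[OF pos])
  qed
  finally show "emeasure (distr P borel (\<lambda>\<omega>. cdf (N_trunc (Z \<omega>)) (X \<omega>))) B
      = emeasure (uniform_measure lborel {0<..<1}) B"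
    by (simp add: D.emeasure_space_1[simplified])
qed simp

end


section \<open>Polyhedral selection events\<close>

lemma distr_std_normal_affine:
  assumes "s > 0"
  shows "distr std_normal borel (\<lambda>x. m + s * x) = density lborel (\<lambda>x. ennreal (normal_density m s x))"
proof -
  interpret N: prob_space std_normal by (rule prob_space_normal_density) simp
  have "distr std_normal lborel (\<lambda>x. x) = std_normal" by (rule distr_id2) simp
  then have "distributed std_normal lborel (\<lambda>x. x) (\<lambda>x. ennreal (std_normal_density x))"
    by (auto simp: distributed_def)
  from N.normal_density_affine[OF this, of s m] assms
  have "distr std_normal lborel (\<lambda>x. m + s * x) = density lborel (\<lambda>x. ennreal (normal_density m s x))"
    by (simp add: distributed_def)
  then show ?thesis by (simp cong: distr_cong)
qed

text \<open>The product of column and row is the rank-one map sending \<open>y\<close> to a multiple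
  of \<open>sel_dir\<close>, with coefficient the inner product of \<open>\<eta>\<close> and
  \<open>y\<close>.\<close>

lemma sel_resid_eq:
  fixes \<eta> y :: "real^'n"
  shows "sel_resid \<Sigma> \<eta> y = y - (\<eta> \<bullet> y) *\<^sub>R sel_dir \<Sigma> \<eta>"
proof -
  have "((columnvector (sel_dir \<Sigma> \<eta>) :: real^1^'n) ** (rowvector \<eta> :: real^'n^1)) *v y
      = (\<eta> \<bullet> y) *\<^sub>R sel_dir \<Sigma> \<eta>"
    by (simp add: vec_eq_iff matrix_vector_mult_def matrix_matrix_mult_def columnvector_def rowvector_def
        inner_vec_def sum_distrib_left mult_ac)
  then show ?thesis
    by (simp add: sel_resid_def matrix_vector_mult_diff_rdistrib)
qed

section \<open>Truncation limits: measurability and the geometry of the polyhedron\<close>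

lemma borel_measurable_matrix_vector_mult[measurable]:
  fixes A :: "real^'n^'m"
  shows "(*v) A \<in> borel_measurable borel"
  by (intro borel_measurable_continuous_onI matrix_vector_mult_linear_continuous_on)

lemma borel_measurable_sel_resid[measurable]: "sel_resid \<Sigma> \<eta> \<in> borel_measurable borel"
  unfolding sel_resid_def by measurable

lemma borel_measurable_matrix_vector_mult_nth[measurable]:
  fixes A :: "real^'n^'m"
  shows "(\<lambda>z. (A *v z) $ j) \<in> borel_measurable borel"
  by (intro borel_measurable_continuous_onI continuous_on_component matrix_vector_mult_linear_continuous_on)

lemma borel_measurable_V_minus[measurable]: "V_minus A b c \<in> borel_measurable borel"
  unfolding V_minus_def by measurable

lemma borel_measurable_V_plus[measurable]: "V_plus A b c \<in> borel_measurable borel"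
  unfolding V_plus_def by measurable

text \<open>Row \<open>j\<close> is an affine inequality in \<open>t\<close> with slope
  \<open>(A *v c) $ j\<close>. A negative slope gives a lower bound, a positive one an upper bound,
  and slope zero a condition on \<open>z\<close> alone. The extrema over empty index sets impose no
  bound.\<close>

lemma polyhedron_iff_truncation:
  fixes A :: "real^'n^'m"
  shows "A *v (z + t *\<^sub>R c) \<le> b \<longleftrightarrow>
    (\<forall>j. (A *v c) $ j = 0 \<longrightarrow> (A *v z) $ j \<le> b $ j) \<and> V_minus A b c z \<le> ereal t \<and> ereal t \<le> V_plus A b c z"
proof -
  have row: "(A *v (z + t *\<^sub>R c)) $ j \<le> b $ j \<longleftrightarrow>
      ((A *v c) $ j = 0 \<longrightarrow> (A *v z) $ j \<le> b $ j) \<and>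
      ((A *v c) $ j < 0 \<longrightarrow> (b $ j - (A *v z) $ j) / (A *v c) $ j \<le> t) \<and>
      ((A *v c) $ j > 0 \<longrightarrow> t \<le> (b $ j - (A *v z) $ j) / (A *v c) $ j)" for j
    by (cases "(A *v c) $ j" "0 :: real" rule: linorder_cases)
      (auto simp: matrix_vector_right_distrib matrix_vector_mult_scaleR field_simps)
  show ?thesis
    unfolding less_eq_vec_def row V_minus_def V_plus_def by (auto simp: SUP_le_iff le_INF_iff)
qed

text \<open>Jointly with the residual, \<open>\<eta> \<bullet> y\<close> factorises because the direction \<open>B\<^sup>T \<eta>\<close> in the standard
  normal coordinates is annihilated by the residual map; this needs no invertibility of \<open>\<Sigma>\<close>.\<close>

lemma distr_sel_resid_inner:
  fixes y :: "'a \<Rightarrow> real^'n"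
  assumes y: "multivariate_normal M y \<mu> \<Sigma>" and v: "\<eta> \<bullet> (\<Sigma> *v \<eta>) > 0"
  shows "distr M (borel \<Otimes>\<^sub>M borel) (\<lambda>\<omega>. (sel_resid \<Sigma> \<eta> (y \<omega>), \<eta> \<bullet> y \<omega>))
    = distr M borel (\<lambda>\<omega>. sel_resid \<Sigma> \<eta> (y \<omega>)) \<Otimes>\<^sub>M
      density lborel (\<lambda>x. ennreal (normal_density (\<eta> \<bullet> \<mu>) (sqrt (\<eta> \<bullet> (\<Sigma> *v \<eta>))) x))"
proof -
  from y obtain B :: "real^'n^'n" where ym[measurable]: "y \<in> borel_measurable M" and B: "B ** transpose B = \<Sigma>"
    and law: "distr M borel y = distr std_gaussian borel (\<lambda>g. \<mu> + B *v g)"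
    by (auto simp: multivariate_normal_def)
  define s where "s = sqrt (\<eta> \<bullet> (\<Sigma> *v \<eta>))"
  \<comment> \<open>\<open>B\<^sup>T \<eta>\<close> has squared norm
    \<open>\<eta> \<bullet> (\<Sigma> *v \<eta>)\<close>, which equals \<open>s * s\<close>;
    dividing by \<open>s\<close> makes it a unit vector.\<close>
  define u where "u = inverse s *\<^sub>R (transpose B *v \<eta>)"
  define r where "r g = sel_resid \<Sigma> \<eta> (\<mu> + B *v g)" for g
  have s: "s > 0" and ss: "s * s = \<eta> \<bullet> (\<Sigma> *v \<eta>)" using v by (simp_all add: s_def)
  have \<eta>B: "\<eta> \<bullet> (B *v g) = s * (u \<bullet> g)" for g
    using s by (simp add: u_def dot_lmul_matrix[symmetric] vector_transpose_matrix)
  have Bu: "B *v u = inverse s *\<^sub>R (\<Sigma> *v \<eta>)"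
    by (simp add: u_def matrix_vector_mult_scaleR matrix_vector_mul_assoc B del: transpose_matrix_vector)
  have "s * (u \<bullet> u) = inverse s * (s * s)"
    unfolding \<eta>B[symmetric] Bu ss by simp
  then have u: "u \<bullet> u = 1" using s by simp
  \<comment> \<open>Shifting \<open>g\<close> by \<open>t *\<^sub>R u\<close> shifts the normal
    vector by \<open>t * s\<close> times \<open>sel_dir\<close> and its inner product with
    \<open>\<eta>\<close> by \<open>t * s\<close>; the two changes cancel in the residual.\<close>
  have inv: "r (g + t *\<^sub>R u) = r g" for g t
    using s v unfolding r_def sel_resid_eq
    by (simp add: matrix_vector_right_distrib matrix_vector_mult_scaleR inner_right_distrib \<eta>B u Bu
        sel_dir_def ss[symmetric] scaleR_add_left algebra_simps)
  have [measurable]: "(\<lambda>g. \<mu> + B *v g) \<in> borel_measurable borel" by simp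
  have [measurable_cong]: "sets (std_gaussian :: (real^'n) measure) = sets borel"
    by (simp add: std_gaussian_def)
  have rm[measurable]: "r \<in> borel_measurable borel"
    unfolding r_def by measurable
  \<comment> \<open>Only the law of \<open>y\<close> is given, so each law computed from
    \<open>y\<close> is transported to the standard Gaussian model.\<close>
  have push: "distr M L (\<lambda>\<omega>. h (y \<omega>)) = distr std_gaussian L (\<lambda>g. h (\<mu> + B *v g))"
    if h: "h \<in> measurable borel L" for h :: "real^'n \<Rightarrow> 'c" and L
  proof -
    have "distr M L (\<lambda>\<omega>. h (y \<omega>)) = distr (distr M borel y) L h"
      using h by (simp add: distr_distr comp_def)
    also have "\<dots> = distr std_gaussian L (\<lambda>g. h (\<mu> + B *v g))"
      unfolding law using h by (subst distr_distr) (auto simp: comp_def)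
    finally show ?thesis .
  qed
  let ?m = "\<lambda>x. \<eta> \<bullet> \<mu> + s * x"
  let ?N = "density lborel (\<lambda>x. ennreal (normal_density (\<eta> \<bullet> \<mu>) s x))"
  interpret N: prob_space ?N using s by (rule prob_space_normal_density)
  have "distr M (borel \<Otimes>\<^sub>M borel) (\<lambda>\<omega>. (sel_resid \<Sigma> \<eta> (y \<omega>), \<eta> \<bullet> y \<omega>))
      = distr std_gaussian (borel \<Otimes>\<^sub>M borel) (\<lambda>g. (r g, ?m (u \<bullet> g)))"
    by (subst push) (simp_all add: r_def inner_right_distrib \<eta>B)
  also have "\<dots> = distr (distr std_gaussian (borel \<Otimes>\<^sub>M borel) (\<lambda>g. (r g, u \<bullet> g))) (borel \<Otimes>\<^sub>M borel) (\<lambda>(z, x). (z, ?m x))"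
    by (subst distr_distr) (auto simp: comp_def)
  also have "\<dots> = distr (distr std_gaussian borel r \<Otimes>\<^sub>M std_normal) (borel \<Otimes>\<^sub>M borel) (\<lambda>(z, x). (z, ?m x))"
    by (simp only: distr_std_gaussian_split[OF u rm inv])
  also have "\<dots> = distr (distr std_gaussian borel r) borel (\<lambda>z. z) \<Otimes>\<^sub>M distr std_normal borel ?m"
    by (rule pair_measure_distr[symmetric])
      (simp_all add: distr_std_normal_affine[OF s] N.sigma_finite_measure_axioms)
  also have "distr std_normal borel ?m = ?N"
    by (rule distr_std_normal_affine[OF s])
  also have "distr (distr std_gaussian borel r) borel (\<lambda>z. z) = distr std_gaussian borel r"
    by (rule distr_id2) simp
  also have "\<dots> = distr M borel (\<lambda>\<omega>. sel_resid \<Sigma> \<eta> (y \<omega>))"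
    by (subst push) (simp_all add: r_def[abs_def])
  finally show ?thesis by (simp only: s_def)
qed

text \<open>A regular conditional distribution is determined only up to null sets. The second claim
  is therefore stated for every version \<open>K\<close>, together with the existence of one, so
  that it is not vacuous.\<close>

theorem theorem5p2:
  fixes M :: "'a measure"
    and y :: "'a \<Rightarrow> real^'n"
    and \<mu> \<eta> :: "real^'n"
    and \<Sigma> :: "real^'n^'n"
    and A :: "real^'n^'m"
    and b :: "real^'m"
  assumes "prob_space M"
    and "multivariate_normal M y \<mu> \<Sigma>"
    and "\<eta> \<bullet> (\<Sigma> *v \<eta>) > 0"
    and "measure M {\<omega>\<in>space M. A *v y \<omega> \<le> b} > 0"
  shows "let v = \<eta> \<bullet> (\<Sigma> *v \<eta>);
             c = sel_dir \<Sigma> \<eta>;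
             z = (\<lambda>\<omega>. sel_resid \<Sigma> \<eta> (y \<omega>));
             P = uniform_measure M {\<omega>\<in>space M. A *v y \<omega> \<le> b};
             U = (\<lambda>\<omega>. trunc_normal_cdf (\<eta> \<bullet> \<mu>) v (V_minus A b c (z \<omega>)) (V_plus A b c (z \<omega>)) (\<eta> \<bullet> y \<omega>))
         in (U \<in> borel_measurable P \<and> distr P borel U = uniform_measure lborel {0<..<1}) \<and>
            (\<exists>K. regular_cond_distr P borel borel (\<lambda>\<omega>. \<eta> \<bullet> y \<omega>) z K) \<and>
            (\<forall>K. regular_cond_distr P borel borel (\<lambda>\<omega>. \<eta> \<bullet> y \<omega>) z K \<longrightarrow>
               (AE z0 in distr P borel z.
                  K z0 = trunc_normal (\<eta> \<bullet> \<mu>) v (V_minus A b c z0) (V_plus A b c z0)))"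
proof -
  define v where "v = \<eta> \<bullet> (\<Sigma> *v \<eta>)"
  define c where "c = sel_dir \<Sigma> \<eta>"
  define z where "z = (\<lambda>\<omega>. sel_resid \<Sigma> \<eta> (y \<omega>))"
  define S where "S = {z. \<forall>j. (A *v c) $ j = 0 \<longrightarrow> (A *v z) $ j \<le> b $ j}"
  let ?N = "density lborel (\<lambda>x. ennreal (normal_density (\<eta> \<bullet> \<mu>) (sqrt v) x))"
  have ym[measurable]: "y \<in> borel_measurable M"
    using assms(2) by (simp add: multivariate_normal_def)
  have zm: "z \<in> borel_measurable M"
    unfolding z_def by measurable
  \<comment> \<open>By the definition of the residual, \<open>y\<close> lies on the line through
    \<open>z\<close> with direction \<open>c\<close>, at parameter
    \<open>\<eta> \<bullet> y\<close>. This turns the polyhedral event into a truncation of that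
    parameter.\<close>
  have y: "y \<omega> = z \<omega> + (\<eta> \<bullet> y \<omega>) *\<^sub>R c" for \<omega>
    by (simp add: z_def c_def sel_resid_eq)
  have event: "A *v y \<omega> \<le> b \<longleftrightarrow> z \<omega> \<in> S \<and> V_minus A b c (z \<omega>) \<le> ereal (\<eta> \<bullet> y \<omega>) \<and> ereal (\<eta> \<bullet> y \<omega>) \<le> V_plus A b c (z \<omega>)" for \<omega>
    using polyhedron_iff_truncation[of A "z \<omega>" "\<eta> \<bullet> y \<omega>" c b] by (simp add: S_def flip: y)
  interpret prob_space M by fact
  have N: "prob_space ?N"
    using assms(3) by (intro prob_space_normal_density) (simp add: v_def)
  interpret truncation M ?N borel "\<lambda>\<omega>. \<eta> \<bullet> y \<omega>" z S "V_minus A b c" "V_plus A b c"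
  proof (intro truncation.intro truncation_axioms.intro prob_space_axioms N zm)
    show "emeasure ?N {x} = 0" for x
      by (simp add: emeasure_density nn_integral_indicator_singleton)
    show "distr M (borel \<Otimes>\<^sub>M borel) (\<lambda>\<omega>. (z \<omega>, \<eta> \<bullet> y \<omega>)) = distr M borel z \<Otimes>\<^sub>M ?N"
      unfolding z_def v_def using assms(2,3) by (rule distr_sel_resid_inner)
    show "S \<in> sets borel"
      unfolding S_def by measurable
    show "emeasure M {\<omega>\<in>space M. z \<omega> \<in> S \<and> V_minus A b c (z \<omega>) \<le> ereal (\<eta> \<bullet> y \<omega>) \<and> ereal (\<eta> \<bullet> y \<omega>) \<le> V_plus A b c (z \<omega>)} > 0"
      using assms(4) by (simp add: event emeasure_eq_measure)
  qed simp_all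
  have P: "uniform_measure M {\<omega>\<in>space M. A *v y \<omega> \<le> b} = P"
    by (simp add: P_def E_def event)
  have T: "trunc_normal (\<eta> \<bullet> \<mu>) v (V_minus A b c z0) (V_plus A b c z0) = N_trunc z0" for z0
    by (simp add: trunc_normal_def N_trunc_def I_def)
  show ?thesis
    unfolding Let_def v_def[symmetric] c_def[symmetric] z_def[symmetric] z_def[THEN fun_cong, symmetric] P trunc_normal_cdf_def T
    using measurable_cdf_N_trunc_pair distr_cdf_N_trunc_pair regular_cond_distr_kernel regular_cond_distr_AE_N_trunc
    by blast
qed

end
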